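(* Let $k,n\ge1$ be integers, let $S_k$ act on $[k]^n$ by $(g\cdot x)_i=g(x_i)$, and let $Q$ be the dual Burnside kernel on $S_k^*$. For $g,h\in S_k^*$ set $a:=|\mathrm{Fix}(g)|$ and $j:=|\mathrm{Fix}(g)\cap\mathrm{Fix}(h)|$. Then $$Q(g,h)=\frac1{a^n}\sum_{r=1}^{\min\{j,n\}}\binom jrS(n,r)\frac{r!}{(k-r)!}=\left(\frac ja\right)^n\mathbb E\big[(k-R_{j,n})!^{-1}\big]=\frac{n!}{a^n}[u^n][z^k]\,e^z(1+z(e^u-1))^j.$$ Here, for $j\ge1$, $R_{j,n}$ is the number of distinct symbols used by a uniform random word in $[j]^n$: $$\mathbb P(R_{j,n}=r)=\frac{\binom jrS(n,r)r!}{j^n}.$$ If $j=0$, all formulas are interpreted as $0$.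
   Context: $[k]=\{1,\dots,k\}$; $\mathrm{Fix}(g)=\{a\in[k]:g(a)=a\}$; $S(n,r)$ is the Stirling number of the second kind; $[u^n]$, $[z^k]$ denote coefficient extraction in formal power series. For the action of $G=S_k$ on $X=[k]^n$: $X_g=\{x\in X:g\cdot x=x\}$, $G_x=\{g\in G:g\cdot x=x\}$, and the dual state space is $S_k^*=\{g\in S_k:X_g\ne\varnothing\}=\{g\in S_k:\mathrm{Fix}(g)\neq\varnothing\}$. The dual Burnside kernel is $Q(g,h)=\frac1{|X_g|}\sum_{x\in X_g\cap X_h}\frac1{|G_x|}$. *)

theory Defs
  imports
    "HOL-Algebra.Group_Action"
    "HOL-Algebra.Sym_Groups"
    "HOL-Combinatorics.Stirling"
    "HOL-Computational_Algebra.Formal_Power_Series"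
    "HOL-Probability.Probability_Mass_Function"
begin

text \<open>
  For a finite group \<open>G\<close> acting on a finite set \<open>X\<close> through \<open>\<phi>\<close>, the sets \<open>X\<^sub>g\<close> and \<open>G\<^sub>x\<close> are
  \<open>invariants X \<phi> g\<close> and \<open>stabilizer G \<phi> x\<close> from \<^theory>\<open>HOL-Algebra.Group_Action\<close>.
\<close>

definition dual_states :: "('g, 'm) monoid_scheme \<Rightarrow> 'x set \<Rightarrow> ('g \<Rightarrow> 'x \<Rightarrow> 'x) \<Rightarrow> 'g set" where
  "dual_states G X \<phi> = {g \<in> carrier G. invariants X \<phi> g \<noteq> {}}"

definition dual_burnside_kernel ::
  "('g, 'm) monoid_scheme \<Rightarrow> 'x set \<Rightarrow> ('g \<Rightarrow> 'x \<Rightarrow> 'x) \<Rightarrow> 'g \<Rightarrow> 'g \<Rightarrow> real" where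
  "dual_burnside_kernel G X \<phi> g h =
     1 / real (card (invariants X \<phi> g)) *
     (\<Sum>x \<in> invariants X \<phi> g \<inter> invariants X \<phi> h. 1 / real (card (stabilizer G \<phi> x)))"

definition words :: "nat \<Rightarrow> nat \<Rightarrow> (nat \<Rightarrow> nat) set" where
  "words k n = {1..n} \<rightarrow>\<^sub>E {1..k}"

text \<open>The outer restriction is required by \<^const>\<open>BijGroup\<close>, whose elements are extensional.\<close>

definition word_action :: "nat \<Rightarrow> nat \<Rightarrow> (nat \<Rightarrow> nat) \<Rightarrow> (nat \<Rightarrow> nat) \<Rightarrow> (nat \<Rightarrow> nat)" where
  "word_action k n g = (\<lambda>x \<in> words k n. \<lambda>i \<in> {1..n}. g (x i))"

definition Fix :: "nat \<Rightarrow> (nat \<Rightarrow> nat) \<Rightarrow> nat set" where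
  "Fix k g = {a \<in> {1..k}. g a = a}"

abbreviation Sstar :: "nat \<Rightarrow> nat \<Rightarrow> (nat \<Rightarrow> nat) set" where
  "Sstar k n \<equiv> dual_states (sym_group k) (words k n) (word_action k n)"

abbreviation Q :: "nat \<Rightarrow> nat \<Rightarrow> (nat \<Rightarrow> nat) \<Rightarrow> (nat \<Rightarrow> nat) \<Rightarrow> real" where
  "Q k n \<equiv> dual_burnside_kernel (sym_group k) (words k n) (word_action k n)"

text \<open>The law of \<open>R\<^sub>j\<^sub>,\<^sub>n\<close>. It is meaningful for \<open>j \<ge> 1\<close> only: \<open>words 0 n\<close> is empty for \<open>n \<ge> 1\<close>.\<close>

definition R_pmf :: "nat \<Rightarrow> nat \<Rightarrow> nat pmf" where
  "R_pmf j n = map_pmf (\<lambda>w. card (w ` {1..n})) (pmf_of_set (words j n))"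

text \<open>
  Bivariate series in \<open>z\<close> and \<open>u\<close> are series in \<open>z\<close> whose coefficients are series in \<open>u\<close>, so
  \<open>[u\<^sup>n][z\<^sup>k] F\<close> is \<open>fps_nth (fps_nth F k) n\<close>. A series \<open>f(u)\<close> is embedded by \<^const>\<open>fps_const\<close>, and a series
  \<open>f(z)\<close> by the following function.
\<close>

definition fps_in_z :: "'a::zero fps \<Rightarrow> 'a fps fps" where
  "fps_in_z f = Abs_fps (\<lambda>m. fps_const (fps_nth f m))"

definition word_gf :: "nat \<Rightarrow> real fps fps" where
  "word_gf j = fps_in_z (fps_exp 1) * (1 + fps_X * fps_const (fps_exp 1 - 1)) ^ j"

lemma word_action_closed:
  assumes "g permutes {1..k}" "x \<in> words k n"
  shows "word_action k n g x \<in> words k n"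
proof -
  have "g (x i) \<in> {1..k}" if "i \<in> {1..n}" for i
    using that assms(2) permutes_in_image[OF assms(1)] unfolding words_def by blast
  then have "(\<lambda>i\<in>{1..n}. g (x i)) \<in> words k n" unfolding words_def by (rule restrict_PiE_iff[THEN iffD2, rule_format])
  then show ?thesis by (simp add: word_action_def assms(2))
qed

lemma word_action_comp:
  assumes "g permutes {1..k}" "h permutes {1..k}" "x \<in> words k n"
  shows "word_action k n (g \<circ> h) x = word_action k n g (word_action k n h x)"
proof -
  have "word_action k n g (word_action k n h x) = (\<lambda>i\<in>{1..n}. g (word_action k n h x i))"
    using word_action_closed[OF assms(2,3)] unfolding word_action_def[of k n g] by (rule restrict_apply')
  also have "\<dots> = (\<lambda>i\<in>{1..n}. g (h (x i)))"
    by (rule restrict_ext) (simp add: word_action_def assms(3))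
  also have "\<dots> = word_action k n (g \<circ> h) x"
    by (simp add: word_action_def assms(3))
  finally show ?thesis by (rule sym)
qed

lemma word_action_id: "x \<in> words k n \<Longrightarrow> word_action k n id x = x"
  by (simp add: word_action_def words_def PiE_restrict)

lemma word_action_Bij:
  assumes "g permutes {1..k}"
  shows "word_action k n g \<in> Bij (words k n)"
proof -
  note i = permutes_inv[OF assms]
  have "bij_betw (word_action k n g) (words k n) (words k n)"
  proof (rule bij_betw_byWitness[where f' = "word_action k n (inv_into UNIV g)"])
    show "\<forall>x\<in>words k n. word_action k n (inv_into UNIV g) (word_action k n g x) = x"
      by (simp add: word_action_comp[OF i assms, symmetric] permutes_inv_o[OF assms] word_action_id)
    show "\<forall>x\<in>words k n. word_action k n g (word_action k n (inv_into UNIV g) x) = x"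
      by (simp add: word_action_comp[OF assms i, symmetric] permutes_inv_o[OF assms] word_action_id)
  qed (auto intro: word_action_closed[OF assms] word_action_closed[OF i])
  then show ?thesis by (simp add: Bij_def word_action_def)
qed

lemma group_action_word_action: "group_action (sym_group k) (words k n) (word_action k n)"
proof -
  have "word_action k n \<in> hom (sym_group k) (BijGroup (words k n))"
  proof (rule homI)
    fix g h assume "g \<in> carrier (sym_group k)" "h \<in> carrier (sym_group k)"
    then have g: "g permutes {1..k}" and h: "h permutes {1..k}" by (simp_all add: sym_group_def)
    have "word_action k n (g \<circ> h) = compose (words k n) (word_action k n g) (word_action k n h)"
    proof (rule extensionalityI[where A = "words k n"])
      show "word_action k n (g \<circ> h) \<in> extensional (words k n)" by (simp add: word_action_def)
    qed (simp_all add: word_action_comp[OF g h] compose_def)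
    then show "word_action k n (g \<otimes>\<^bsub>sym_group k\<^esub> h) =
        word_action k n g \<otimes>\<^bsub>BijGroup (words k n)\<^esub> word_action k n h"
      by (simp add: sym_group_def BijGroup_def word_action_Bij[OF g] word_action_Bij[OF h])
  qed (simp add: sym_group_def BijGroup_def word_action_Bij)
  then show ?thesis
    by (intro group_action.intro group_hom.intro group_hom_axioms.intro sym_group_is_group
        group_BijGroup)
qed

lemma dual_states_word_action:
  assumes "n \<ge> 1"
  shows "Sstar k n = {g \<in> carrier (sym_group k). Fix k g \<noteq> {}}"
proof -
  have "invariants (words k n) (word_action k n) g \<noteq> {} \<longleftrightarrow> Fix k g \<noteq> {}" for g
  proof
    assume "invariants (words k n) (word_action k n) g \<noteq> {}"
    then obtain x where x: "x \<in> words k n" "word_action k n g x = x"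
      by (auto simp: invariants_def)
    have "g (x 1) = word_action k n g x 1" using assms x(1) by (simp add: word_action_def)
    then have "g (x 1) = x 1" by (simp add: x(2))
    moreover have "x 1 \<in> {1..k}" using assms x(1) by (auto simp: words_def)
    ultimately show "Fix k g \<noteq> {}" by (auto simp: Fix_def)
  next
    assume "Fix k g \<noteq> {}"
    then obtain a where "a \<in> {1..k}" "g a = a" by (auto simp: Fix_def)
    then have "(\<lambda>i\<in>{1..n}. a) \<in> invariants (words k n) (word_action k n) g"
      by (auto simp: invariants_def word_action_def words_def)
    then show "invariants (words k n) (word_action k n) g \<noteq> {}" by blast
  qed
  then show ?thesis by (simp add: dual_states_def)
qed

end

theory Submission
  imports Defs
begin

text \<open>
  The words fixed by \<open>g\<close> are the words over \<open>Fix g\<close>, and the stabilizer of a word with \<open>r\<close> distinct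
  letters is the symmetric group on the other \<open>k - r\<close> letters. Hence \<open>a\<^sup>n Q(g,h)\<close> is the sum of
  \<open>1/(k - |x|)!\<close> over the words \<open>x\<close> over \<open>Fix g \<inter> Fix h\<close>, where \<open>|x|\<close> is the number of distinct
  letters. Grouping by \<open>|x|\<close> gives the Stirling sum, normalising the sum gives the expectation, and
  \<open>n![u\<^sup>n](e\<^sup>u - 1)\<^sup>r = r! S(n,r)\<close> gives the generating function.
\<close>

section \<open>Words by number of distinct letters\<close>

lemma Stirling_pos_0: "n \<ge> 1 \<Longrightarrow> Stirling n 0 = 0"
  by (cases n) simp_all

lemma Suc_times_binomial_real:
  "real (Suc r) * real (j choose Suc r) = (real j - real r) * real (j choose r)"
proof (cases "r \<le> j")
  case True
  have "Suc r * (j choose Suc r) = (j - r) * (j choose r)"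
    by (simp only: binomial_absorption binomial_absorb_comp)
  then show ?thesis
    using True by (metis of_nat_diff of_nat_mult)
qed (simp add: binomial_eq_0)

text \<open>The Stirling recurrence tested against a weight \<open>f\<close>. \<open>w j n r\<close>
  counts the words of length \<open>n\<close> over \<open>j\<close> letters that use
  \<open>r\<close> of them; one more letter repeats a used one in \<open>r\<close> ways or is new in
  \<open>j - r\<close> ways.\<close>

lemma Stirling_sum_Suc:
  fixes f :: "nat \<Rightarrow> real"
  defines "w \<equiv> \<lambda>j n r. real (j choose r) * real (Stirling n r) * fact r"
  shows "(\<Sum>r\<le>Suc n. w j (Suc n) r * f r) =
         (\<Sum>r\<le>n. w j n r * (real r * f r + (real j - real r) * f (Suc r)))"
proof -
  have step: "w j (Suc n) (Suc r) * f (Suc r) =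
      w j n (Suc r) * (real (Suc r) * f (Suc r)) + w j n r * ((real j - real r) * f (Suc r))" for r
  proof -
    have "real (j choose Suc r) * (fact (Suc r)) = (real j - real r) * real (j choose r) * fact r"
      using Suc_times_binomial_real[of r j] by (simp add: mult_ac)
    then have "w j n r * ((real j - real r) * f (Suc r)) =
        real (j choose Suc r) * (fact (Suc r)) * real (Stirling n r) * f (Suc r)"
      by (simp add: w_def mult_ac)
    then show ?thesis
      by (simp add: w_def algebra_simps del: fact_Suc)
  qed
  have "(\<Sum>r\<le>Suc n. w j (Suc n) r * f r) = (\<Sum>r\<le>n. w j (Suc n) (Suc r) * f (Suc r))"
    by (subst sum.atMost_Suc_shift) (simp add: w_def)
  also have "\<dots> = (\<Sum>r\<le>n. w j n (Suc r) * (real (Suc r) * f (Suc r))) +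
      (\<Sum>r\<le>n. w j n r * ((real j - real r) * f (Suc r)))"
    by (simp only: step sum.distrib)
  \<comment> \<open>The index shift adds the term \<open>r = 0\<close>, killed by the factor
    \<open>real r\<close>; the top term \<open>r = Suc n\<close> then drops out because
    \<open>Stirling n (Suc n) = 0\<close>.\<close>
  also have "(\<Sum>r\<le>n. w j n (Suc r) * (real (Suc r) * f (Suc r))) =
      (\<Sum>r\<le>Suc n. w j n r * (real r * f r))"
    by (subst sum.atMost_Suc_shift) simp
  also have "\<dots> = (\<Sum>r\<le>n. w j n r * (real r * f r))"
    by (simp add: w_def)
  finally show ?thesis
    by (simp add: sum.distrib distrib_left)
qed

lemma sum_PiE_insert:
  fixes F :: "('a \<Rightarrow> 'b) \<Rightarrow> real"
  assumes "i \<notin> A"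
  shows "(\<Sum>x\<in>insert i A \<rightarrow>\<^sub>E B. F x) = (\<Sum>x\<in>A \<rightarrow>\<^sub>E B. \<Sum>b\<in>B. F (x(i := b)))"
proof -
  have "(\<Sum>x\<in>insert i A \<rightarrow>\<^sub>E B. F x) = (\<Sum>(b, x)\<in>B \<times> (A \<rightarrow>\<^sub>E B). F (x(i := b)))"
    unfolding PiE_insert_eq using inj_combinator[OF assms, of "\<lambda>_. B"]
    by (subst sum.reindex) (auto intro!: sum.cong)
  also have "\<dots> = (\<Sum>b\<in>B. \<Sum>x\<in>A \<rightarrow>\<^sub>E B. F (x(i := b)))"
    by (simp add: sum.cartesian_product)
  also have "\<dots> = (\<Sum>x\<in>A \<rightarrow>\<^sub>E B. \<Sum>b\<in>B. F (x(i := b)))"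
    by (rule sum.swap)
  finally show ?thesis .
qed

text \<open>A letter already in \<open>C\<close> keeps the cardinality and any other raises it by
  one. The result has the shape of the summand in \<open>Stirling_sum_Suc\<close>.\<close>

lemma sum_card_insert:
  fixes f :: "nat \<Rightarrow> real"
  assumes "finite B" "C \<subseteq> B"
  shows "(\<Sum>b\<in>B. f (card (insert b C))) =
         real (card C) * f (card C) + (real (card B) - real (card C)) * f (Suc (card C))"
proof -
  have fin: "finite C"
    using assms finite_subset by blast
  have "(\<Sum>b\<in>B. f (card (insert b C))) =
      (\<Sum>b\<in>B - C. f (card (insert b C))) + (\<Sum>b\<in>C. f (card (insert b C)))"
    using assms by (rule sum.subset_diff[rotated])
  also have "(\<Sum>b\<in>B - C. f (card (insert b C))) = (\<Sum>b\<in>B - C. f (Suc (card C)))"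
    using fin by (intro sum.cong) auto
  also have "(\<Sum>b\<in>C. f (card (insert b C))) = (\<Sum>b\<in>C. f (card C))"
    by (intro sum.cong) (auto simp: insert_absorb)
  finally show ?thesis
    using card_mono[OF assms] by (simp add: card_Diff_subset[OF fin assms(2)] of_nat_diff)
qed

text \<open>Induction on the set of positions. The weight \<open>f\<close> stays arbitrary because
  summing out the letter at the new position replaces it by
  \<open>r f(r) + (|B| - r) f(r+1)\<close>, to which the induction hypothesis is applied. The kernel
  and the law of \<open>R_pmf\<close> are both instances.\<close>

lemma sum_words_by_card_image:
  fixes f :: "nat \<Rightarrow> real"
  assumes "finite A" "finite B"
  shows "(\<Sum>x\<in>A \<rightarrow>\<^sub>E B. f (card (x ` A))) =
         (\<Sum>r\<le>card A. real (card B choose r) * real (Stirling (card A) r) * fact r * f r)"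
  using assms(1)
proof (induction A arbitrary: f rule: finite_induct)
  case empty
  then show ?case by simp
next
  case (insert i A)
  have "(\<Sum>x\<in>insert i A \<rightarrow>\<^sub>E B. f (card (x ` insert i A))) =
      (\<Sum>x\<in>A \<rightarrow>\<^sub>E B. \<Sum>b\<in>B. f (card (insert b (x ` A))))"
  proof (subst sum_PiE_insert[OF insert.hyps(2)], intro sum.cong refl)
    fix x b
    have "x(i := b) ` insert i A = insert b (x ` A)"
      using insert.hyps(2) by auto
    then show "f (card (x(i := b) ` insert i A)) = f (card (insert b (x ` A)))"
      by simp
  qed
  also have "\<dots> = (\<Sum>x\<in>A \<rightarrow>\<^sub>E B. real (card (x ` A)) * f (card (x ` A)) +
      (real (card B) - real (card (x ` A))) * f (Suc (card (x ` A))))"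
    by (intro sum.cong refl sum_card_insert[OF assms(2)]) auto
  also have "\<dots> = (\<Sum>r\<le>card A. real (card B choose r) * real (Stirling (card A) r) * fact r *
      (real r * f r + (real (card B) - real r) * f (Suc r)))"
    by (rule insert.IH)
  also have "\<dots> = (\<Sum>r\<le>Suc (card A).
      real (card B choose r) * real (Stirling (Suc (card A)) r) * fact r * f r)"
    by (rule Stirling_sum_Suc[symmetric])
  finally show ?case
    using insert.hyps by simp
qed

section \<open>Fixed words and stabilizers\<close>

lemma invariants_word_action:
  "invariants (words k n) (word_action k n) g = {1..n} \<rightarrow>\<^sub>E Fix k g"
proof (intro Set.set_eqI iffI)
  fix x assume "x \<in> invariants (words k n) (word_action k n) g"
  then have x: "x \<in> words k n" and "(\<lambda>i\<in>{1..n}. g (x i)) = x"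
    by (auto simp: invariants_def word_action_def)
  then have "g (x i) = x i" if "i \<in> {1..n}" for i
    using that by (metis restrict_apply')
  with x show "x \<in> {1..n} \<rightarrow>\<^sub>E Fix k g"
    by (auto simp: words_def Fix_def PiE_iff)
next
  fix x assume x: "x \<in> {1..n} \<rightarrow>\<^sub>E Fix k g"
  then have "x \<in> words k n" "(\<lambda>i\<in>{1..n}. g (x i)) = x"
    by (auto simp: words_def Fix_def PiE_iff extensional_def fun_eq_iff)
  then show "x \<in> invariants (words k n) (word_action k n) g"
    by (simp add: invariants_def word_action_def)
qed

lemma stabilizer_word_action:
  assumes "x \<in> words k n"
  shows "stabilizer (sym_group k) (word_action k n) x = {p. p permutes ({1..k} - x ` {1..n})}"
proof (intro Set.set_eqI iffI)
  fix p assume "p \<in> stabilizer (sym_group k) (word_action k n) x"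
  then have p: "p permutes {1..k}" and "(\<lambda>i\<in>{1..n}. p (x i)) = x"
    using assms by (auto simp: stabilizer_def sym_group_carrier word_action_def)
  then have "p (x i) = x i" if "i \<in> {1..n}" for i
    using that by (metis restrict_apply')
  then show "p \<in> {p. p permutes ({1..k} - x ` {1..n})}"
    using p by (auto intro: permutes_superset)
next
  fix p assume "p \<in> {p. p permutes ({1..k} - x ` {1..n})}"
  then have p: "p permutes ({1..k} - x ` {1..n})"
    by simp
  have "p (x i) = x i" if "i \<in> {1..n}" for i
    using that by (intro permutes_not_in[OF p]) auto
  then have "(\<lambda>i\<in>{1..n}. p (x i)) = x"
    using assms by (auto simp: words_def PiE_iff extensional_def fun_eq_iff)
  moreover have "p permutes {1..k}"
    using p by (rule permutes_subset) auto
  ultimately show "p \<in> stabilizer (sym_group k) (word_action k n) x"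
    using assms by (simp add: stabilizer_def sym_group_carrier word_action_def)
qed

lemma card_stabilizer_word_action:
  assumes "x \<in> words k n"
  shows "card (stabilizer (sym_group k) (word_action k n) x) = fact (k - card (x ` {1..n}))"
proof -
  have "x ` {1..n} \<subseteq> {1..k}"
    using assms by (auto simp: words_def)
  then have "card ({1..k} - x ` {1..n}) = k - card (x ` {1..n})"
    by (simp add: card_Diff_subset)
  then show ?thesis
    unfolding stabilizer_word_action[OF assms] by (rule card_permutations) simp
qed

lemma finite_Fix: "finite (Fix k g)"
  by (simp add: Fix_def)

lemma Q_eq_sum_words:
  "Q k n g h = 1 / real (card (Fix k g)) ^ n *
     (\<Sum>x\<in>{1..n} \<rightarrow>\<^sub>E Fix k g \<inter> Fix k h. 1 / fact (k - card (x ` {1..n})))"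
proof -
  have "invariants (words k n) (word_action k n) g \<inter> invariants (words k n) (word_action k n) h =
      {1..n} \<rightarrow>\<^sub>E Fix k g \<inter> Fix k h"
    unfolding invariants_word_action PiE_Int ..
  moreover have "x \<in> words k n" if "x \<in> {1..n} \<rightarrow>\<^sub>E Fix k g \<inter> Fix k h" for x
    using that by (auto simp: words_def Fix_def PiE_iff)
  ultimately show ?thesis
    by (simp add: dual_burnside_kernel_def invariants_word_action card_funcsetE
        card_stabilizer_word_action)
qed

lemma Q_eq_Stirling_sum:
  "Q k n g h = 1 / real (card (Fix k g)) ^ n *
     (\<Sum>r\<le>n. real (card (Fix k g \<inter> Fix k h) choose r) * real (Stirling n r) * fact r *
       (1 / fact (k - r)))"
  unfolding Q_eq_sum_words
  by (subst sum_words_by_card_image[of _ _ "\<lambda>r. 1 / fact (k - r)"]) (simp_all add: finite_Fix)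

section \<open>The number of distinct letters of a random word\<close>

lemma finite_words: "finite (words j n)"
  by (simp add: words_def finite_PiE)

lemma words_nonempty: "j \<ge> 1 \<Longrightarrow> words j n \<noteq> {}"
  by (simp add: words_def PiE_eq_empty_iff)

lemma card_words: "card (words j n) = j ^ n"
  by (simp add: words_def card_funcsetE)

text \<open>The same sum over words as in the kernel, divided by the \<open>j ^ n\<close> words;
  \<open>j \<ge> 1\<close> makes \<open>words j n\<close> nonempty, so that the uniform distribution
  makes sense.\<close>

lemma expectation_R_pmf:
  fixes f :: "nat \<Rightarrow> real"
  assumes "j \<ge> 1"
  shows "measure_pmf.expectation (R_pmf j n) f =
         (\<Sum>r\<le>n. real (j choose r) * real (Stirling n r) * fact r * f r) / real j ^ n"
proof -
  have "(\<Sum>x\<in>words j n. f (card (x ` {1..n}))) =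
      (\<Sum>r\<le>n. real (j choose r) * real (Stirling n r) * fact r * f r)"
    unfolding words_def by (subst sum_words_by_card_image) simp_all
  then show ?thesis
    by (simp add: R_pmf_def integral_pmf_of_set[OF words_nonempty[OF assms] finite_words]
        card_words)
qed

lemma pmf_R_pmf:
  assumes "j \<ge> 1"
  shows "pmf (R_pmf j n) r = real (j choose r) * real (Stirling n r) * fact r / real j ^ n"
proof -
  have "pmf (R_pmf j n) r = measure_pmf.expectation (R_pmf j n) (indicator {r})"
    by (simp add: measure_pmf_single)
  also have "\<dots> = (\<Sum>s\<le>n. real (j choose s) * real (Stirling n s) * fact s * indicator {r} s) /
      real j ^ n"
    by (rule expectation_R_pmf[OF assms])
  also have "(\<Sum>s\<le>n. real (j choose s) * real (Stirling n s) * fact s * indicator {r} s) =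
      real (j choose r) * real (Stirling n r) * fact r"
    \<comment> \<open>For \<open>r > n\<close> the indicator picks out nothing, in agreement with
      \<open>Stirling n r = 0\<close>.\<close>
    by (cases "r \<le> n") (auto simp: indicator_def if_distrib sum.delta cong: if_cong)
  finally show ?thesis .
qed

section \<open>The generating function\<close>

text \<open>With \<open>E = e^u - 1\<close> one has \<open>E' = E + 1\<close>, hence
  \<open>(E^(s+1))' = (s+1)(E^(s+1) + E^s)\<close>. Comparing coefficients gives the Stirling
  recurrence, scaled by factorials.\<close>

lemma fps_nth_exp_minus_1_power:
  "fact n * fps_nth ((fps_exp 1 - 1 :: real fps) ^ r) n = fact r * real (Stirling n r)"
proof (induction n arbitrary: r)
  case 0
  show ?case
    by (cases r) (simp_all add: fps_nth_power_0)
next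
  case (Suc n)
  show ?case
  proof (cases r)
    case 0
    then show ?thesis by simp
  next
    case (Suc s)
    define E :: "real fps" where "E = fps_exp 1 - 1"
    have "fps_deriv (E ^ Suc s) = of_nat (Suc s) * fps_exp 1 * E ^ s"
      by (subst fps_deriv_power') (simp add: E_def)
    also have "\<dots> = fps_const (real (Suc s)) * (E ^ Suc s + E ^ s)"
      by (simp add: E_def fps_of_nat[symmetric] algebra_simps)
    finally have "fps_nth (fps_deriv (E ^ Suc s)) n =
        real (Suc s) * (fps_nth (E ^ Suc s) n + fps_nth (E ^ s) n)"
      by (simp only: fps_mult_left_const_nth fps_add_nth)
    \<comment> \<open>The derivative contributes the factor \<open>Suc n\<close>, which turns
      \<open>fact n\<close> into \<open>fact (Suc n)\<close> below.\<close>
    then have "real (Suc n) * fps_nth (E ^ Suc s) (Suc n) =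
        real (Suc s) * (fps_nth (E ^ Suc s) n + fps_nth (E ^ s) n)"
      by (simp del: power_Suc)
    then have "fact n * (real (Suc n) * fps_nth (E ^ Suc s) (Suc n)) =
        fact n * (real (Suc s) * (fps_nth (E ^ Suc s) n + fps_nth (E ^ s) n))"
      by (simp only:)
    then have "fact (Suc n) * fps_nth (E ^ Suc s) (Suc n) =
        real (Suc s) * (fact n * fps_nth (E ^ Suc s) n + fact n * fps_nth (E ^ s) n)"
      by (simp only: fact_Suc distrib_left of_nat_fact mult_ac)
    also have "\<dots> = fact (Suc s) * real (Stirling (Suc n) (Suc s))"
      unfolding E_def Suc.IH by (simp add: algebra_simps)
    finally show ?thesis
      by (simp only: E_def Suc)
  qed
qed

text \<open>Expand the power binomially: \<open>z^r\<close> shifts the index, leaving the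
  coefficient \<open>1/(k-r)!\<close> of \<open>e^z\<close>. The bound \<open>j \<le> k\<close>
  gives \<open>r \<le> k\<close> throughout; for \<open>r > k\<close> the coefficient would be 0,
  but the truncated \<open>fact (k - r)\<close> is 1.\<close>

lemma word_gf_nth_z:
  assumes "j \<le> k"
  shows "fps_nth (word_gf j) k =
         (\<Sum>r\<le>j. fps_const (real (j choose r) / fact (k - r)) * (fps_exp 1 - 1) ^ r)"
proof -
  define c :: "real fps" where "c = fps_exp 1 - 1"
  have "(1 + fps_X * fps_const c) ^ j = (\<Sum>r\<le>j. of_nat (j choose r) * (fps_X * fps_const c) ^ r)"
    using binomial_ring[of "fps_X * fps_const c" 1 j] by (simp add: add.commute)
  \<comment> \<open>Everything free of \<open>z\<close> is gathered into one
    \<open>fps_const\<close>, so that extracting the coefficient of \<open>z^k\<close> is a mere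
    shift.\<close>
  also have "\<dots> = (\<Sum>r\<le>j. fps_X ^ r * fps_const (of_nat (j choose r) * c ^ r))"
    by (simp add: power_mult_distrib fps_of_nat[symmetric] fps_const_mult[symmetric] mult_ac
        del: fps_const_mult)
  finally have "word_gf j = (\<Sum>r\<le>j. fps_X ^ r *
      (fps_in_z (fps_exp 1) * fps_const (of_nat (j choose r) * c ^ r)))"
    by (simp add: word_gf_def c_def sum_distrib_left mult_ac)
  then have "fps_nth (word_gf j) k = (\<Sum>r\<le>j. fps_const (1 / fact (k - r)) *
      (of_nat (j choose r) * c ^ r))"
    using assms by (simp add: fps_sum_nth fps_X_power_mult_nth fps_in_z_def)
  also have "\<dots> = (\<Sum>r\<le>j. fps_const (real (j choose r) / fact (k - r)) * c ^ r)"
    by (intro sum.cong refl) (simp add: fps_of_nat[symmetric] mult.assoc[symmetric])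
  finally show ?thesis
    by (simp add: c_def)
qed

lemma word_gf_nth:
  assumes "j \<le> k"
  shows "fact n * fps_nth (fps_nth (word_gf j) k) n =
         (\<Sum>r\<le>j. real (j choose r) * real (Stirling n r) * (fact r / fact (k - r)))"
proof -
  have "fact n * fps_nth (fps_nth (word_gf j) k) n = (\<Sum>r\<le>j. real (j choose r) / fact (k - r) *
      (fact n * fps_nth ((fps_exp 1 - 1 :: real fps) ^ r) n))"
    by (simp add: word_gf_nth_z[OF assms] fps_sum_nth sum_distrib_left mult_ac)
  then show ?thesis
    by (simp only: fps_nth_exp_minus_1_power) (simp add: mult_ac)
qed

theorem theorem4p3:
  fixes k n a j :: nat and g h :: "nat \<Rightarrow> nat"
  assumes "k \<ge> 1" and "n \<ge> 1"
    and "g \<in> Sstar k n" and "h \<in> Sstar k n"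
    and "a = card (Fix k g)" and "j = card (Fix k g \<inter> Fix k h)"
  shows "Q k n g h =
           1 / real a ^ n *
           (\<Sum>r = 1..min j n. real (j choose r) * real (Stirling n r) * (fact r / fact (k - r)))
       \<and> Q k n g h =
           (real j / real a) ^ n * measure_pmf.expectation (R_pmf j n) (\<lambda>r. 1 / fact (k - r))
       \<and> Q k n g h = fact n / real a ^ n * fps_nth (fps_nth (word_gf j) k) n
       \<and> (j \<ge> 1 \<longrightarrow>
           (\<forall>r. pmf (R_pmf j n) r =
                  real (j choose r) * real (Stirling n r) * fact r / real j ^ n))
       \<and> (j = 0 \<longrightarrow> Q k n g h = 0)"
proof -
  define t where "t r = real (j choose r) * real (Stirling n r) * (fact r / fact (k - r))" for r
  have "Fix k g \<inter> Fix k h \<subseteq> {1..k}"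
    by (auto simp: Fix_def)
  then have "j \<le> k"
    unfolding assms(6) by (metis card_atLeastAtMost card_mono diff_Suc_1 finite_atLeastAtMost)
  \<comment> \<open>\<open>Stirling n 0 = 0\<close> as \<open>n \<ge> 1\<close>, the binomial
    vanishes for \<open>r > j\<close>, and the Stirling number for \<open>r > n\<close>. This
    reduces the range up to \<open>n\<close> (from words) and the range up to \<open>j\<close> (from
    the series) to the same sum.\<close>
  have t0: "t r = 0" if "r \<notin> {1..min j n}" for r
    using that Stirling_pos_0[OF assms(2)] by (cases "r = 0") (auto simp: t_def not_le)
  have sum_n: "(\<Sum>r\<le>n. t r) = (\<Sum>r = 1..min j n. t r)"
    by (rule sum.mono_neutral_right) (use t0 in auto)
  have sum_j: "(\<Sum>r\<le>j. t r) = (\<Sum>r = 1..min j n. t r)"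
    by (rule sum.mono_neutral_right) (use t0 in auto)
  have Q1: "Q k n g h = 1 / real a ^ n * (\<Sum>r = 1..min j n. t r)"
    using Q_eq_Stirling_sum[of k n g h] unfolding sum_n[symmetric] assms(5,6)[symmetric]
    by (simp add: t_def)
  have Q0: "Q k n g h = 0" if "j = 0"
    unfolding Q1 using that by simp
  have Q2: "Q k n g h =
      (real j / real a) ^ n * measure_pmf.expectation (R_pmf j n) (\<lambda>r. 1 / fact (k - r))"
  proof (cases "j = 0")
    \<comment> \<open>\<open>R_pmf 0 n\<close> has no meaning here, but its expectation is
      multiplied by \<open>(0 / a) ^ n\<close>, which is 0 because \<open>n \<ge> 1\<close>.\<close>
    case True
    then show ?thesis
      using Q0 assms(2) by simp
  next
    case False
    then have "measure_pmf.expectation (R_pmf j n) (\<lambda>r. 1 / fact (k - r)) =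
        (\<Sum>r\<le>n. t r) / real j ^ n"
      by (subst expectation_R_pmf) (simp_all add: t_def)
    then show ?thesis
      using False by (simp add: Q1 sum_n power_divide)
  qed
  have Q3: "Q k n g h = fact n / real a ^ n * fps_nth (fps_nth (word_gf j) k) n"
    using word_gf_nth[OF \<open>j \<le> k\<close>, of n] unfolding Q1 sum_j[symmetric] by (simp add: t_def)
  show ?thesis
    using Q1 Q2 Q3 Q0 pmf_R_pmf unfolding t_def by blast
qed

end
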